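(* Let $\mathcal{S}$ be either the semiring $\mathbb{R}_+$ of nonnegative real numbers with the usual operations $(+,\times)$ or the Boolean semiring $\mathcal{B}=\{0,1\}$ with operations $(\lor,\land)$. Let $X \in \mathcal{S}^{N,M}$ have $\mathrm{rk}_{\mathcal{S}}(X) = R$. Then the factorization $X = W \cdot H$ with $W \in \mathcal{S}^{N,R}$, $H \in \mathcal{S}^{R,M}$ has a unique $W$ (that is, whenever $X = W_1 \cdot H_1 = W_2 \cdot H_2$ with $W_1, W_2 \in \mathcal{S}^{N,R}$ and $H_1,H_2 \in \mathcal{S}^{R,M}$, one has $W_2 = W_1 \cdot U$ for some invertible $U \in \mathcal{S}^{R,R}$) if and only if there exists a unique cone $\mathcal{C} \subset \mathcal{S}^N$ of order $R$ such that $\mathrm{cone}(X) \subset \mathcal{C}$.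
   Context: All matrix products, sums and scalar multiplications are taken with the operations of $\mathcal{S}$. The rank is $\mathrm{rk}_{\mathcal{S}}(X) = \min\{R : X = W\cdot H,\ W \in \mathcal{S}^{N,R},\ H \in \mathcal{S}^{R,M}\}$. A matrix $U \in \mathcal{S}^{R,R}$ is invertible if there is $U^{-1} \in \mathcal{S}^{R,R}$ with $U \cdot U^{-1} = U^{-1}\cdot U = I$ (for $\mathbb{R}_+$ the inverse must thus also be nonnegative). A cone is a (nonempty) subset $\mathcal{C} \subset \mathcal{S}^N$ closed under addition from $\mathcal{S}^N$ and scalar multiplication by $\mathcal{S}$. A set $G \subset \mathcal{C}$ is a generating set of $\mathcal{C}$ if $\mathcal{C}$ is the set of all finite linear combinations of elements of $G$ with coefficients in $\mathcal{S}$. The order of $\mathcal{C}$ is the size of a minimal generating set; all cones considered are finitely generated, i.e. of finite order. For a matrix $X \in \mathcal{S}^{N,M}$, $\mathrm{cone}(X) = \{X \cdot h : h \in \mathcal{S}^M\} \subset \mathcal{S}^N$. *)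

theory Defs
  imports Complex_Main "Jordan_Normal_Form.Matrix"
begin

typedef nnreal = "{x :: real. 0 \<le> x}"
  morphisms real_of_nnreal nnreal_of_real
  by auto

setup_lifting type_definition_nnreal

instantiation nnreal :: comm_semiring_1
begin

lift_definition zero_nnreal :: nnreal is 0 by simp
lift_definition one_nnreal :: nnreal is 1 by simp
lift_definition plus_nnreal :: "nnreal \<Rightarrow> nnreal \<Rightarrow> nnreal" is "(+)" by simp
lift_definition times_nnreal :: "nnreal \<Rightarrow> nnreal \<Rightarrow> nnreal" is "(*)" by simp

instance
  by standard (transfer; simp add: algebra_simps)+

end

instantiation bool :: comm_semiring_1
begin

definition zero_bool :: bool where "zero_bool = False"
definition one_bool :: bool where "one_bool = True"
definition plus_bool :: "bool \<Rightarrow> bool \<Rightarrow> bool" where "plus_bool = (\<or>)"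
definition times_bool :: "bool \<Rightarrow> bool \<Rightarrow> bool" where "times_bool = (\<and>)"

instance
  by standard (auto simp: zero_bool_def one_bool_def plus_bool_def times_bool_def)

end

definition semiring_rank :: "'a :: comm_semiring_1 mat \<Rightarrow> nat" where
  "semiring_rank X = (LEAST R. \<exists>W H. W \<in> carrier_mat (dim_row X) R \<and>
     H \<in> carrier_mat R (dim_col X) \<and> X = W * H)"

text \<open>The inverse required by \<^const>\<open>invertible_mat\<close> has its entries in the semiring itself.\<close>

definition unique_left_factor :: "nat \<Rightarrow> 'a :: comm_semiring_1 mat \<Rightarrow> bool" where
  "unique_left_factor R X \<longleftrightarrow>
     (\<forall>W\<^sub>1 W\<^sub>2 H\<^sub>1 H\<^sub>2.
        W\<^sub>1 \<in> carrier_mat (dim_row X) R \<and> W\<^sub>2 \<in> carrier_mat (dim_row X) R \<and>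
        H\<^sub>1 \<in> carrier_mat R (dim_col X) \<and> H\<^sub>2 \<in> carrier_mat R (dim_col X) \<and>
        X = W\<^sub>1 * H\<^sub>1 \<and> X = W\<^sub>2 * H\<^sub>2 \<longrightarrow>
        (\<exists>U \<in> carrier_mat R R. invertible_mat U \<and> W\<^sub>2 = W\<^sub>1 * U))"

definition is_cone :: "nat \<Rightarrow> 'a :: comm_semiring_1 vec set \<Rightarrow> bool" where
  "is_cone N C \<longleftrightarrow> C \<noteq> {} \<and> C \<subseteq> carrier_vec N \<and>
     (\<forall>x \<in> C. \<forall>y \<in> C. x + y \<in> C) \<and> (\<forall>a. \<forall>x \<in> C. a \<cdot>\<^sub>v x \<in> C)"

definition generates :: "nat \<Rightarrow> 'a :: comm_semiring_1 vec set \<Rightarrow> 'a vec set \<Rightarrow> bool" where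
  "generates N G C \<longleftrightarrow> G \<subseteq> C \<and>
     C = {finsum_vec TYPE('a) N (\<lambda>g. c g \<cdot>\<^sub>v g) F | c F. finite F \<and> F \<subseteq> G}"

definition finitely_generated :: "nat \<Rightarrow> 'a :: comm_semiring_1 vec set \<Rightarrow> bool" where
  "finitely_generated N C \<longleftrightarrow> (\<exists>G. finite G \<and> generates N G C)"

text \<open>Minimality of a generating set is read as least cardinality; over the two semirings above,
  every inclusion-minimal generating set of a finitely generated cone has this same size.
  The value is meaningful only for finitely generated cones.\<close>

definition cone_order :: "nat \<Rightarrow> 'a :: comm_semiring_1 vec set \<Rightarrow> nat" where
  "cone_order N C = (LEAST k. \<exists>G. finite G \<and> generates N G C \<and> card G = k)"

definition cone_of_mat :: "'a :: comm_semiring_1 mat \<Rightarrow> 'a vec set" where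
  "cone_of_mat X = {X *\<^sub>v h | h. h \<in> carrier_vec (dim_col X)}"

end

theory Submission
  imports Defs
begin

text \<open>
  A cone of order \<open>R\<close> is \<open>cone(W)\<close> for a matrix \<open>W\<close> with \<open>R\<close> columns, and \<open>cone(X) \<subseteq> cone(W)\<close> means
  that \<open>X = W H\<close> for some \<open>H\<close>; so the cones of order \<open>R = rk X\<close> around \<open>cone(X)\<close> are the cones of the
  left factors of size \<open>R\<close>. It remains to see that two left factors \<open>W\<^sub>1\<close>, \<open>W\<^sub>2\<close> with the same cone differ
  by an invertible matrix. Both have rank \<open>R\<close>, so no column is a combination of the others. Writing
  \<open>W\<^sub>2 = W\<^sub>1 U\<close> and \<open>W\<^sub>1 = W\<^sub>2 V\<close>, over the nonnegative reals \<open>W\<^sub>1 = W\<^sub>1 (U V)\<close> forces \<open>U V = I\<close>. Over the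
  Booleans \<open>U\<close> itself need not be invertible, but irredundancy makes each column of \<open>W\<^sub>2\<close> a column of
  \<open>W\<^sub>1\<close>, so that \<open>W\<^sub>2 = W\<^sub>1 Q\<close> for a permutation matrix \<open>Q\<close>.
\<close>

section \<open>Rank\<close>

lemma index_mult_mat_sum:
  assumes "W \<in> carrier_mat N R" "H \<in> carrier_mat R M" "r < N" "c < M"
  shows "(W * H) $$ (r, c) = (\<Sum>k\<in>{0..<R}. W $$ (r, k) * H $$ (k, c))"
  using assms by (auto simp: scalar_prod_def intro!: sum.cong)

lemma index_mult_mat_vec_sum:
  assumes "W \<in> carrier_mat N R" "h \<in> carrier_vec R" "r < N"
  shows "(W *\<^sub>v h) $ r = (\<Sum>k\<in>{0..<R}. W $$ (r, k) * h $ k)"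
  using assms by (auto simp: scalar_prod_def intro!: sum.cong)

lemma semiring_rank_le:
  assumes "X \<in> carrier_mat N M" "W \<in> carrier_mat N R" "H \<in> carrier_mat R M" "X = W * H"
  shows "semiring_rank X \<le> R"
  unfolding semiring_rank_def by (rule Least_le) (use assms in auto)

text \<open>The trivial factorization \<open>X = X * 1\<^sub>m M\<close> shows that some inner
  dimension works, so the \<open>LEAST\<close> in the definition of the rank is attained.\<close>

lemma semiring_rank_factorization:
  assumes "(X :: 'a :: comm_semiring_1 mat) \<in> carrier_mat N M"
  obtains W H where "W \<in> carrier_mat N (semiring_rank X)" "H \<in> carrier_mat (semiring_rank X) M"
    "X = W * H"
proof -
  let ?P = "\<lambda>R. \<exists>W H. W \<in> carrier_mat (dim_row X) R \<and> H \<in> carrier_mat R (dim_col X) \<and> X = W * H"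
  have "?P (dim_col X)"
    by (rule exI[of _ X], rule exI[of _ "1\<^sub>m (dim_col X)"]) (auto simp: right_mult_one_mat)
  from LeastI[of ?P, OF this] show thesis
    using assms that unfolding semiring_rank_def[symmetric] by auto
qed

lemma semiring_rank_le_card:
  assumes X: "(X :: 'a :: comm_semiring_1 mat) \<in> carrier_mat N M" and A: "finite A"
    and eq: "\<And>r c. r < N \<Longrightarrow> c < M \<Longrightarrow> X $$ (r, c) = (\<Sum>k\<in>A. a r k * b k c)"
  shows "semiring_rank X \<le> card A"
proof -
  obtain f where f: "bij_betw f {0..<card A} A"
    using ex_bij_betw_nat_finite[OF A] by blast
  define W where "W = mat N (card A) (\<lambda>(r, k). a r (f k))"
  define H where "H = mat (card A) M (\<lambda>(k, c). b (f k) c)"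
  have W: "W \<in> carrier_mat N (card A)" and H: "H \<in> carrier_mat (card A) M"
    by (auto simp: W_def H_def)
  have "X = W * H"
  proof (rule eq_matI)
    fix r c assume "r < dim_row (W * H)" "c < dim_col (W * H)"
    then have rc: "r < N" "c < M" using W H by auto
    have "X $$ (r, c) = (\<Sum>k\<in>{0..<card A}. a r (f k) * b (f k) c)"
      unfolding eq[OF rc] by (rule sum.reindex_bij_betw[OF f, symmetric])
    also have "\<dots> = (W * H) $$ (r, c)"
      unfolding index_mult_mat_sum[OF W H rc] using rc by (auto simp: W_def H_def)
    finally show "X $$ (r, c) = (W * H) $$ (r, c)" .
  qed (use W H X in auto)
  then show ?thesis using semiring_rank_le[OF X W H] by blast
qed

text \<open>If column \<open>i\<close> were a combination of the others, deleting it would leave a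
  left factor of \<open>W\<close> with only \<open>R - 1\<close> columns. This is the one form in
  which minimality of \<open>R\<close> enters the arguments for the two semirings.\<close>

lemma column_irredundant:
  assumes W: "(W :: 'a :: comm_semiring_1 mat) \<in> carrier_mat N R" and rank: "semiring_rank W = R"
    and i: "i < R"
    and eq: "\<And>r. r < N \<Longrightarrow> W $$ (r, i) = (\<Sum>k\<in>{0..<R} - {i}. W $$ (r, k) * p k)"
  shows False
proof -
  have "semiring_rank W \<le> card ({0..<R} - {i})"
  proof (rule semiring_rank_le_card[OF W])
    fix r c assume rc: "r < N" "c < R"
    \<comment> \<open>Column \<open>i\<close> of the right factor holds the coefficients
      \<open>p\<close>; every other column is a unit vector that reproduces a surviving column of
      \<open>W\<close>.\<close>
    show "W $$ (r, c) = (\<Sum>k\<in>{0..<R} - {i}. W $$ (r, k) * (if c = i then p k else if k = c then 1 else 0))"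
    proof (cases "c = i")
      case False
      have "(\<Sum>k\<in>{0..<R} - {i}. W $$ (r, k) * (if k = c then 1 else 0))
          = (\<Sum>k\<in>{0..<R} - {i}. if k = c then W $$ (r, k) else 0)"
        by (intro sum.cong) auto
      also have "\<dots> = W $$ (r, c)" using rc False by simp
      finally show ?thesis using False by simp
    qed (use eq rc in simp)
  qed simp
  then show False using rank i by simp
qed

text \<open>Any factorization \<open>W = A * B\<close> passes on to \<open>X = A * (B * H)\<close>
  with the same inner dimension, so \<open>W\<close> cannot have smaller rank than
  \<open>X\<close>.\<close>

lemma semiring_rank_left_factor:
  assumes X: "(X :: 'a :: comm_semiring_1 mat) \<in> carrier_mat N M" "X = W * H" "semiring_rank X = R"
    and W: "W \<in> carrier_mat N R" and H: "H \<in> carrier_mat R M"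
  shows "semiring_rank W = R"
proof (rule antisym)
  show "semiring_rank W \<le> R"
    by (rule semiring_rank_le[OF W W one_carrier_mat]) (use W in simp)
  obtain A B where AB: "A \<in> carrier_mat N (semiring_rank W)" "B \<in> carrier_mat (semiring_rank W) R"
    "W = A * B"
    using semiring_rank_factorization[OF W] .
  have "X = A * (B * H)"
    unfolding X(2) AB(3) by (rule assoc_mult_mat[OF AB(1,2) H])
  then have "semiring_rank X \<le> semiring_rank W"
    by (intro semiring_rank_le[OF X(1) AB(1)]) (use AB H in auto)
  then show "R \<le> semiring_rank W" using X by simp
qed

section \<open>Cones\<close>

lemma zero_in_cone:
  assumes "is_cone N C"
  shows "0\<^sub>v N \<in> C"
proof -
  obtain x where "x \<in> C" "x \<in> carrier_vec N" using assms unfolding is_cone_def by blast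
  then have "0 \<cdot>\<^sub>v x \<in> C" "0 \<cdot>\<^sub>v x = 0\<^sub>v N" using assms unfolding is_cone_def by auto
  then show ?thesis by simp
qed

lemma finsum_in_cone:
  fixes C :: "'a :: comm_semiring_1 vec set"
  assumes C: "is_cone N C" and "finite F" "F \<subseteq> C"
  shows "finsum_vec TYPE('a) N (\<lambda>g. c g \<cdot>\<^sub>v g) F \<in> C"
  using assms(2,3)
proof (induction F)
  case empty
  show ?case using zero_in_cone[OF C] by (simp add: finsum_vec_empty)
next
  case (insert x F)
  have carr: "C \<subseteq> carrier_vec N" using C by (simp add: is_cone_def)
  have "finsum_vec TYPE('a) N (\<lambda>g. c g \<cdot>\<^sub>v g) (insert x F)
      = c x \<cdot>\<^sub>v x + finsum_vec TYPE('a) N (\<lambda>g. c g \<cdot>\<^sub>v g) F"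
    by (rule finsum_vec_insert) (use insert carr in auto)
  then show ?case using insert C by (auto simp: is_cone_def)
qed

section \<open>Cones spanned by the columns of a matrix\<close>

lemma is_cone_cone_of_mat:
  assumes W: "W \<in> carrier_mat N R"
  shows "is_cone N (cone_of_mat W)"
  unfolding is_cone_def
proof (intro conjI ballI allI)
  show "cone_of_mat W \<noteq> {}" unfolding cone_of_mat_def using zero_carrier_vec by blast
  show "cone_of_mat W \<subseteq> carrier_vec N" unfolding cone_of_mat_def using W by auto
next
  fix x y assume "x \<in> cone_of_mat W" "y \<in> cone_of_mat W"
  then obtain g h where gh: "g \<in> carrier_vec R" "h \<in> carrier_vec R" "x = W *\<^sub>v g" "y = W *\<^sub>v h"
    using W unfolding cone_of_mat_def by auto
  then have "x + y = W *\<^sub>v (g + h)" by (simp add: mult_add_distrib_mat_vec[OF W])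
  then show "x + y \<in> cone_of_mat W" using gh W unfolding cone_of_mat_def by auto
next
  fix a x assume "x \<in> cone_of_mat W"
  then obtain g where g: "g \<in> carrier_vec R" "x = W *\<^sub>v g"
    using W unfolding cone_of_mat_def by auto
  have "a \<cdot>\<^sub>v x = W *\<^sub>v (a \<cdot>\<^sub>v g)"
  proof (rule eq_vecI)
    fix r assume "r < dim_vec (W *\<^sub>v (a \<cdot>\<^sub>v g))"
    then have r: "r < N" using W by simp
    show "(a \<cdot>\<^sub>v x) $ r = (W *\<^sub>v (a \<cdot>\<^sub>v g)) $ r"
      using index_mult_mat_vec_sum[OF W, of g r] index_mult_mat_vec_sum[OF W, of "a \<cdot>\<^sub>v g" r] g r W
      by (simp add: sum_distrib_left mult.left_commute)
  qed (use g in simp)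
  then show "a \<cdot>\<^sub>v x \<in> cone_of_mat W" using g W unfolding cone_of_mat_def by auto
qed

lemma col_in_cone_of_mat:
  assumes W: "W \<in> carrier_mat N R" and j: "j < R"
  shows "col W j \<in> cone_of_mat W"
proof -
  have "col W j = col (W * 1\<^sub>m R) j" using W by simp
  also have "\<dots> = W *\<^sub>v col (1\<^sub>m R) j" by (rule col_mult2[OF W one_carrier_mat j])
  finally show ?thesis using W j unfolding cone_of_mat_def by auto
qed

text \<open>Inclusion of cones only has to be tested on the columns of \<open>X\<close>; their
  coefficient vectors with respect to \<open>W\<close>, placed side by side, form \<open>H\<close>.
  The converse is associativity.\<close>

lemma cone_of_mat_subset_iff:
  fixes X :: "'a :: comm_semiring_1 mat"
  assumes X: "X \<in> carrier_mat N M" and W: "W \<in> carrier_mat N R"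
  shows "cone_of_mat X \<subseteq> cone_of_mat W \<longleftrightarrow> (\<exists>H \<in> carrier_mat R M. X = W * H)"
proof
  assume sub: "cone_of_mat X \<subseteq> cone_of_mat W"
  have "\<exists>h. h \<in> carrier_vec R \<and> col X j = W *\<^sub>v h" if "j < M" for j
    using col_in_cone_of_mat[OF X that] sub W unfolding cone_of_mat_def by auto
  then obtain h where h: "\<And>j. j < M \<Longrightarrow> h j \<in> carrier_vec R \<and> col X j = W *\<^sub>v h j"
    by metis
  define H where "H = mat R M (\<lambda>(k, j). h j $ k)"
  have H: "H \<in> carrier_mat R M" by (simp add: H_def)
  have "X = W * H"
  proof (rule mat_col_eqI)
    fix j assume "j < dim_col (W * H)"
    then have j: "j < M" using H by simp
    have "col H j = h j" using j h[OF j] by (auto simp: H_def)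
    then show "col X j = col (W * H) j" using h[OF j] col_mult2[OF W H j] by simp
  qed (use X W H in auto)
  then show "\<exists>H \<in> carrier_mat R M. X = W * H" using H by blast
next
  assume "\<exists>H \<in> carrier_mat R M. X = W * H"
  then obtain H where H: "H \<in> carrier_mat R M" "X = W * H" by blast
  show "cone_of_mat X \<subseteq> cone_of_mat W"
  proof
    fix x assume "x \<in> cone_of_mat X"
    then obtain h where h: "h \<in> carrier_vec M" "x = X *\<^sub>v h"
      using X unfolding cone_of_mat_def by auto
    then have "x = W *\<^sub>v (H *\<^sub>v h)" using H assoc_mult_mat_vec[OF W H(1)] by simp
    moreover have "H *\<^sub>v h \<in> carrier_vec R" using H h by simp
    ultimately show "x \<in> cone_of_mat W" using W unfolding cone_of_mat_def by blast
  qed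
qed

lemma generates_cone_of_mat:
  fixes W :: "'a :: comm_semiring_1 mat"
  assumes W: "W \<in> carrier_mat N R"
  shows "generates N (col W ` {0..<R}) (cone_of_mat W)"
proof -
  let ?G = "col W ` {0..<R}"
  let ?S = "{finsum_vec TYPE('a) N (\<lambda>g. c g \<cdot>\<^sub>v g) F | c F. finite F \<and> F \<subseteq> ?G}"
  have G: "?G \<subseteq> cone_of_mat W" using col_in_cone_of_mat[OF W] by auto
  have Gc: "?G \<subseteq> carrier_vec N" using W by auto
  have "?S \<subseteq> cone_of_mat W"
  proof safe
    fix c F assume "finite F" "F \<subseteq> ?G"
    then show "finsum_vec TYPE('a) N (\<lambda>g. c g \<cdot>\<^sub>v g) F \<in> cone_of_mat W"
      by (intro finsum_in_cone[OF is_cone_cone_of_mat[OF W]] order.trans[OF _ G])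
  qed
  moreover have "cone_of_mat W \<subseteq> ?S"
  proof
    fix x assume "x \<in> cone_of_mat W"
    then obtain h where h: "h \<in> carrier_vec R" "x = W *\<^sub>v h"
      using W unfolding cone_of_mat_def by auto
    \<comment> \<open>Generators form a set, so equal columns of \<open>W\<close> collapse to one
      element \<open>g\<close>; its coefficient collects the entries of \<open>h\<close> over all
      positions where \<open>g\<close> occurs.\<close>
    define c where "c g = (\<Sum>k\<in>{k\<in>{0..<R}. col W k = g}. h $ k)" for g
    have fs: "finsum_vec TYPE('a) N (\<lambda>g. c g \<cdot>\<^sub>v g) ?G \<in> carrier_vec N"
      by (rule finsum_vec_closed) (use Gc in auto)
    have "x = finsum_vec TYPE('a) N (\<lambda>g. c g \<cdot>\<^sub>v g) ?G"
    proof (rule eq_vecI)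
      fix r assume "r < dim_vec (finsum_vec TYPE('a) N (\<lambda>g. c g \<cdot>\<^sub>v g) ?G)"
      then have r: "r < N" using fs by auto
      have "x $ r = (\<Sum>k\<in>{0..<R}. W $$ (r, k) * h $ k)"
        using index_mult_mat_vec_sum[OF W h(1) r] h(2) by simp
      also have "\<dots> = (\<Sum>g\<in>?G. \<Sum>k\<in>{k\<in>{0..<R}. col W k = g}. W $$ (r, k) * h $ k)"
        by (rule sum.image_gen) simp
      also have "\<dots> = (\<Sum>g\<in>?G. c g * g $ r)"
      proof (rule sum.cong[OF refl])
        fix g assume "g \<in> ?G"
        have "(\<Sum>k\<in>{k\<in>{0..<R}. col W k = g}. W $$ (r, k) * h $ k)
            = (\<Sum>k\<in>{k\<in>{0..<R}. col W k = g}. h $ k * g $ r)"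
          by (rule sum.cong) (use W r in \<open>auto simp: mult.commute\<close>)
        then show "(\<Sum>k\<in>{k\<in>{0..<R}. col W k = g}. W $$ (r, k) * h $ k) = c g * g $ r"
          by (simp add: c_def sum_distrib_right)
      qed
      also have "\<dots> = (\<Sum>g\<in>?G. (c g \<cdot>\<^sub>v g) $ r)"
        by (rule sum.cong) (use W r in auto)
      also have "\<dots> = finsum_vec TYPE('a) N (\<lambda>g. c g \<cdot>\<^sub>v g) ?G $ r"
        by (rule index_finsum_vec[symmetric]) (use r Gc in auto)
      finally show "x $ r = finsum_vec TYPE('a) N (\<lambda>g. c g \<cdot>\<^sub>v g) ?G $ r" .
    qed (use fs h W in auto)
    then show "x \<in> ?S"
      by (intro CollectI exI[of _ c] exI[of _ ?G]) simp
  qed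
  ultimately show ?thesis using G unfolding generates_def by (intro conjI subset_antisym)
qed

text \<open>Enumerate \<open>G\<close> as the columns of \<open>W\<close>. A generating set
  determines its cone, and \<open>G\<close> generates both \<open>C\<close> and
  \<open>cone_of_mat W\<close>.\<close>

lemma generates_imp_cone_of_mat:
  fixes C :: "'a :: comm_semiring_1 vec set"
  assumes C: "is_cone N C" and G: "finite G" "generates N G C"
  obtains W where "W \<in> carrier_mat N (card G)" "C = cone_of_mat W"
proof -
  obtain f where f: "bij_betw f {0..<card G} G"
    using ex_bij_betw_nat_finite[OF G(1)] by blast
  define W where "W = mat N (card G) (\<lambda>(r, k). f k $ r)"
  have W: "W \<in> carrier_mat N (card G)" by (simp add: W_def)
  have Gc: "G \<subseteq> carrier_vec N" using C G unfolding is_cone_def generates_def by blast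
  have colW: "col W k = f k" if "k < card G" for k
  proof -
    have "f k \<in> carrier_vec N" using f that Gc by (auto simp: bij_betw_def)
    then show ?thesis using that by (auto simp: W_def)
  qed
  have "col W ` {0..<card G} = f ` {0..<card G}" using colW by auto
  also have "\<dots> = G" using f by (simp add: bij_betw_def)
  finally have "generates N G (cone_of_mat W)" using generates_cone_of_mat[OF W] by simp
  then have "C = cone_of_mat W" using G(2) unfolding generates_def by simp
  then show thesis using that W by blast
qed

lemma finitely_generated_imp_cone_of_mat:
  fixes C :: "'a :: comm_semiring_1 vec set"
  assumes C: "is_cone N C" and fg: "finitely_generated N C"
  obtains W where "W \<in> carrier_mat N (cone_order N C)" "C = cone_of_mat W"
proof -
  have "\<exists>k G. finite G \<and> generates N G C \<and> card G = k"
    using fg unfolding finitely_generated_def by blast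
  from LeastI_ex[OF this] obtain G where "finite G" "generates N G C" "card G = cone_order N C"
    unfolding cone_order_def by blast
  then show thesis using generates_imp_cone_of_mat[OF C] that by metis
qed

text \<open>The columns of \<open>W\<close> bound the order by \<open>R\<close>. Conversely, a
  generating set of least size gives a matrix \<open>V\<close> whose cone contains that of
  \<open>X\<close>, hence a factorization of \<open>X\<close> through as many columns, and the rank
  forbids fewer than \<open>R\<close>.\<close>

lemma cone_of_left_factor:
  fixes X :: "'a :: comm_semiring_1 mat"
  assumes X: "X \<in> carrier_mat N M" "semiring_rank X = R" "X = W * H"
    and W: "W \<in> carrier_mat N R" and H: "H \<in> carrier_mat R M"
  shows "is_cone N (cone_of_mat W) \<and> finitely_generated N (cone_of_mat W) \<and>
    cone_order N (cone_of_mat W) = R \<and> cone_of_mat X \<subseteq> cone_of_mat W"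
proof (intro conjI)
  show cone: "is_cone N (cone_of_mat W)" by (rule is_cone_cone_of_mat[OF W])
  show fg: "finitely_generated N (cone_of_mat W)"
    unfolding finitely_generated_def
    by (rule exI[of _ "col W ` {0..<R}"]) (simp add: generates_cone_of_mat[OF W])
  show sub: "cone_of_mat X \<subseteq> cone_of_mat W"
    using cone_of_mat_subset_iff[OF X(1) W] H X(3) by blast
  have "cone_order N (cone_of_mat W) \<le> card (col W ` {0..<R})"
    unfolding cone_order_def
    by (rule Least_le, rule exI[of _ "col W ` {0..<R}"]) (simp add: generates_cone_of_mat[OF W])
  also have "\<dots> \<le> R" using card_image_le[of "{0..<R}" "col W"] by simp
  finally have "cone_order N (cone_of_mat W) \<le> R" .
  moreover obtain V where V: "V \<in> carrier_mat N (cone_order N (cone_of_mat W))"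
    "cone_of_mat W = cone_of_mat V"
    using finitely_generated_imp_cone_of_mat[OF cone fg] .
  then obtain K where K: "K \<in> carrier_mat (cone_order N (cone_of_mat W)) M" "X = V * K"
    using sub cone_of_mat_subset_iff[OF X(1) V(1)] by auto
  then have "R \<le> cone_order N (cone_of_mat W)"
    using semiring_rank_le[OF X(1) V(1) K] X(2) by simp
  ultimately show "cone_order N (cone_of_mat W) = R" by simp
qed

text \<open>The part of the argument common to all commutative semirings. What depends on the
  semiring is isolated in \<open>change\<close>: two full-rank generating matrices that express each
  other differ by an invertible matrix. It serves the direction from a unique cone to a unique
  factor.\<close>

lemma unique_left_factor_iff_unique_cone:
  fixes X :: "'a :: comm_semiring_1 mat"
  assumes X: "X \<in> carrier_mat N M" "semiring_rank X = R"
    and change: "\<And>W\<^sub>1 W\<^sub>2 U V :: 'a mat. \<lbrakk>W\<^sub>1 \<in> carrier_mat N R; W\<^sub>2 \<in> carrier_mat N R;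
      semiring_rank W\<^sub>1 = R; semiring_rank W\<^sub>2 = R; U \<in> carrier_mat R R; V \<in> carrier_mat R R;
      W\<^sub>2 = W\<^sub>1 * U; W\<^sub>1 = W\<^sub>2 * V\<rbrakk> \<Longrightarrow> \<exists>U \<in> carrier_mat R R. invertible_mat U \<and> W\<^sub>2 = W\<^sub>1 * U"
  shows "unique_left_factor R X \<longleftrightarrow>
    (\<exists>!C. is_cone N C \<and> finitely_generated N C \<and> cone_order N C = R \<and> cone_of_mat X \<subseteq> C)"
    (is "_ \<longleftrightarrow> (\<exists>!C. ?P C)")
proof
  have dim: "dim_row X = N" "dim_col X = M" using X(1) by auto
  assume uniq: "unique_left_factor R X"
  have le: "\<exists>W H. W \<in> carrier_mat N R \<and> H \<in> carrier_mat R M \<and> X = W * H \<and> C = cone_of_mat W"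
    if "?P C" for C
  proof -
    have C: "is_cone N C" "finitely_generated N C" "cone_order N C = R"
      and sub: "cone_of_mat X \<subseteq> C" using that by auto
    obtain W where W: "W \<in> carrier_mat N R" "C = cone_of_mat W"
      using finitely_generated_imp_cone_of_mat[OF C(1,2)] unfolding C(3) .
    then obtain H where "H \<in> carrier_mat R M" "X = W * H"
      using cone_of_mat_subset_iff[OF X(1) W(1)] sub W(2) by blast
    then show ?thesis using W by blast
  qed
  \<comment> \<open>Applying uniqueness to the two factors in either order yields both inclusions,
    so the inverse of \<open>U\<close> never has to be handled.\<close>
  have sub: "cone_of_mat W\<^sub>2 \<subseteq> cone_of_mat W\<^sub>1"
    if "W\<^sub>1 \<in> carrier_mat N R" "H\<^sub>1 \<in> carrier_mat R M" "X = W\<^sub>1 * H\<^sub>1"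
      "W\<^sub>2 \<in> carrier_mat N R" "H\<^sub>2 \<in> carrier_mat R M" "X = W\<^sub>2 * H\<^sub>2" for W\<^sub>1 W\<^sub>2 H\<^sub>1 H\<^sub>2
  proof -
    have "\<exists>U \<in> carrier_mat R R. invertible_mat U \<and> W\<^sub>2 = W\<^sub>1 * U"
      by (rule uniq[unfolded unique_left_factor_def dim, rule_format, of W\<^sub>1 W\<^sub>2 H\<^sub>1 H\<^sub>2])
        (intro conjI that)
    then have "\<exists>U \<in> carrier_mat R R. W\<^sub>2 = W\<^sub>1 * U" by blast
    then show ?thesis unfolding cone_of_mat_subset_iff[OF that(4,1)] .
  qed
  obtain W H where WH: "W \<in> carrier_mat N R" "H \<in> carrier_mat R M" "X = W * H"
    using semiring_rank_factorization[OF X(1)] unfolding X(2) .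
  show "\<exists>!C. ?P C"
  proof (rule ex1I)
    show "?P (cone_of_mat W)" by (rule cone_of_left_factor[OF X WH(3,1,2)])
  next
    fix C assume "?P C"
    from le[OF this] obtain V K where V: "V \<in> carrier_mat N R" "K \<in> carrier_mat R M" "X = V * K"
      and C: "C = cone_of_mat V" by blast
    show "C = cone_of_mat W"
      unfolding C by (rule subset_antisym[OF sub[OF WH V] sub[OF V WH]])
  qed
next
  have dim: "dim_row X = N" "dim_col X = M" using X(1) by auto
  assume uniq: "\<exists>!C. ?P C"
  show "unique_left_factor R X"
    unfolding unique_left_factor_def dim
  proof (intro allI impI, elim conjE)
    fix W\<^sub>1 W\<^sub>2 H\<^sub>1 H\<^sub>2
    assume W: "W\<^sub>1 \<in> carrier_mat N R" "W\<^sub>2 \<in> carrier_mat N R"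
      and H: "H\<^sub>1 \<in> carrier_mat R M" "H\<^sub>2 \<in> carrier_mat R M"
      and eq1: "X = W\<^sub>1 * H\<^sub>1" and eq2: "X = W\<^sub>2 * H\<^sub>2"
    have eq: "cone_of_mat W\<^sub>1 = cone_of_mat W\<^sub>2"
      by (rule Uniq_D[OF ex1_iff_ex_Uniq[THEN iffD1, OF uniq, THEN conjunct2]
            cone_of_left_factor[OF X eq1 W(1) H(1)] cone_of_left_factor[OF X eq2 W(2) H(2)]])
    obtain U where U: "U \<in> carrier_mat R R" "W\<^sub>2 = W\<^sub>1 * U"
      using cone_of_mat_subset_iff[OF W(2,1)] unfolding eq by auto
    obtain V where V: "V \<in> carrier_mat R R" "W\<^sub>1 = W\<^sub>2 * V"
      using cone_of_mat_subset_iff[OF W] unfolding eq by auto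
    show "\<exists>U \<in> carrier_mat R R. invertible_mat U \<and> W\<^sub>2 = W\<^sub>1 * U"
      by (rule change[OF W semiring_rank_left_factor[OF X(1) eq1 X(2) W(1) H(1)]
            semiring_rank_left_factor[OF X(1) eq2 X(2) W(2) H(2)] U(1) V(1) U(2) V(2)])
  qed
qed

section \<open>Nonnegative reals\<close>

lemma real_of_nnreal_sum: "real_of_nnreal (sum f A) = (\<Sum>x\<in>A. real_of_nnreal (f x))"
  by (induction A rule: infinite_finite_induct)
     (simp_all add: zero_nnreal.rep_eq plus_nnreal.rep_eq)

lemma real_of_nnreal_nonneg: "0 \<le> real_of_nnreal x"
  using real_of_nnreal[of x] by simp

text \<open>Write \<open>p\<close> for the entries of \<open>P\<close>. Column \<open>i\<close> of
  \<open>W = W * P\<close> says that column \<open>i\<close> of \<open>W\<close> times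
  \<open>1 - p i i\<close> equals the combination of the other columns with weights
  \<open>p l i\<close>. If \<open>p i i < 1\<close>, dividing contradicts irredundancy. Otherwise
  the two sides have opposite signs and vanish; since no column of \<open>W\<close> is zero,
  \<open>p i i = 1\<close> and the other weights are 0.\<close>

lemma nnreal_mult_fixed_imp_one:
  fixes W :: "nnreal mat"
  assumes W: "W \<in> carrier_mat N R" and rank: "semiring_rank W = R"
    and P: "P \<in> carrier_mat R R" and eq: "W = W * P"
  shows "P = 1\<^sub>m R"
proof (rule eq_matI)
  let ?w = "\<lambda>r k. real_of_nnreal (W $$ (r, k))"
  let ?p = "\<lambda>k i. real_of_nnreal (P $$ (k, i))"
  fix k i assume "k < dim_row (1\<^sub>m R :: nnreal mat)" "i < dim_col (1\<^sub>m R :: nnreal mat)"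
  then have k: "k < R" and i: "i < R" by auto
  define T where "T r = (\<Sum>l\<in>{0..<R} - {i}. ?w r l * ?p l i)" for r
  have T: "0 \<le> T r" for r
    unfolding T_def by (intro sum_nonneg mult_nonneg_nonneg real_of_nnreal_nonneg)
  have row: "?w r i = ?w r i * ?p i i + T r" if r: "r < N" for r
  proof -
    have "W $$ (r, i) = (\<Sum>l\<in>{0..<R}. W $$ (r, l) * P $$ (l, i))"
      using eq index_mult_mat_sum[OF W P r i] by simp
    then have "?w r i = (\<Sum>l\<in>{0..<R}. ?w r l * ?p l i)"
      by (simp add: real_of_nnreal_sum times_nnreal.rep_eq)
    also have "\<dots> = ?w r i * ?p i i + T r"
      unfolding T_def by (rule sum.remove) (use i in auto)
    finally show ?thesis .
  qed
  \<comment> \<open>A zero column would be the combination of the other columns with all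
    coefficients 0.\<close>
  have nonzero: "\<exists>r<N. 0 < ?w r l" if l: "l < R" for l
  proof (rule ccontr)
    assume "\<not> (\<exists>r<N. 0 < ?w r l)"
    then have "?w r l = 0" if "r < N" for r
      using that real_of_nnreal_nonneg[of "W $$ (r, l)"] by force
    then have "W $$ (r, l) = 0" if "r < N" for r
      using that by (simp add: real_of_nnreal_inject[symmetric] zero_nnreal.rep_eq)
    then show False using column_irredundant[OF W rank l, of "\<lambda>_. 0"] by simp
  qed
  have "\<not> ?p i i < 1"
  proof
    assume lt: "?p i i < 1"
    \<comment> \<open>Solve the fixed-point equation for column \<open>i\<close>.\<close>
    define q where "q l = nnreal_of_real (?p l i / (1 - ?p i i))" for l
    have q: "real_of_nnreal (q l) = ?p l i / (1 - ?p i i)" for l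
      unfolding q_def by (rule nnreal_of_real_inverse) (use lt real_of_nnreal_nonneg in simp)
    have "W $$ (r, i) = (\<Sum>l\<in>{0..<R} - {i}. W $$ (r, l) * q l)" if r: "r < N" for r
    proof -
      have "?w r i = T r / (1 - ?p i i)" using row[OF r] lt by (simp add: field_simps)
      then show ?thesis
        by (simp add: real_of_nnreal_inject[symmetric] real_of_nnreal_sum times_nnreal.rep_eq q
            T_def sum_divide_distrib)
    qed
    then show False by (rule column_irredundant[OF W rank i])
  qed
  then have ge: "1 \<le> ?p i i" by simp
  have zero: "T r = 0 \<and> ?w r i * (?p i i - 1) = 0" if r: "r < N" for r
  proof -
    have "T r + ?w r i * (?p i i - 1) = 0" using row[OF r] by (simp add: algebra_simps)
    moreover have "0 \<le> ?w r i * (?p i i - 1)" using ge real_of_nnreal_nonneg by simp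
    ultimately show ?thesis using T[of r] by linarith
  qed
  show "P $$ (k, i) = 1\<^sub>m R $$ (k, i)"
  proof (cases "k = i")
    case True
    obtain r where "r < N" "0 < ?w r i" using nonzero[OF i] by blast
    then have "?p i i = 1" using zero[of r] by simp
    then show ?thesis
      using True i by (simp add: real_of_nnreal_inject[symmetric] one_nnreal.rep_eq)
  next
    case False
    obtain r where r: "r < N" "0 < ?w r k" using nonzero[OF k] by blast
    have "\<forall>l\<in>{0..<R} - {i}. ?w r l * ?p l i = 0"
      using zero[OF r(1)] unfolding T_def
      by (subst (asm) sum_nonneg_eq_0_iff) (auto intro: mult_nonneg_nonneg real_of_nnreal_nonneg)
    then have "?w r k * ?p k i = 0" using False k by simp
    then have "?p k i = 0" using r(2) by simp
    then show ?thesis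
      using False i k by (simp add: real_of_nnreal_inject[symmetric] zero_nnreal.rep_eq)
  qed
qed (use P in auto)

text \<open>Here the given \<open>U\<close> is itself invertible with inverse \<open>V\<close>:
  \<open>U * V\<close> fixes \<open>W\<^sub>1\<close> and \<open>V * U\<close> fixes
  \<open>W\<^sub>2\<close>, so both products are the identity.\<close>

lemma nnreal_change_of_generators:
  fixes W\<^sub>1 W\<^sub>2 U V :: "nnreal mat"
  assumes W: "W\<^sub>1 \<in> carrier_mat N R" "W\<^sub>2 \<in> carrier_mat N R"
    and rank: "semiring_rank W\<^sub>1 = R" "semiring_rank W\<^sub>2 = R"
    and UV: "U \<in> carrier_mat R R" "V \<in> carrier_mat R R"
    and eq: "W\<^sub>2 = W\<^sub>1 * U" "W\<^sub>1 = W\<^sub>2 * V"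
  shows "\<exists>U \<in> carrier_mat R R. invertible_mat U \<and> W\<^sub>2 = W\<^sub>1 * U"
proof -
  have "W\<^sub>1 = W\<^sub>1 * (U * V)"
    using assoc_mult_mat[OF W(1) UV] eq by argo
  then have "U * V = 1\<^sub>m R"
    by (intro nnreal_mult_fixed_imp_one[OF W(1) rank(1)]) (use UV in auto)
  moreover have "W\<^sub>2 = W\<^sub>2 * (V * U)"
    using assoc_mult_mat[OF W(2) UV(2,1)] eq by argo
  then have "V * U = 1\<^sub>m R"
    by (intro nnreal_mult_fixed_imp_one[OF W(2) rank(2)]) (use UV in auto)
  ultimately have "invertible_mat U"
    using UV unfolding invertible_mat_def inverts_mat_def by auto
  then show ?thesis using eq UV by blast
qed

section \<open>Booleans\<close>

lemma bool_sum_iff: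
  assumes "finite A"
  shows "(\<Sum>x\<in>A. f x :: bool) \<longleftrightarrow> (\<exists>x\<in>A. f x)"
  using assms by (induction A) (auto simp: zero_bool_def plus_bool_def)

lemma bool_mult_mat_iff:
  assumes "(W :: bool mat) \<in> carrier_mat N R" "H \<in> carrier_mat R M" "r < N" "c < M"
  shows "(W * H) $$ (r, c) \<longleftrightarrow> (\<exists>k<R. W $$ (r, k) \<and> H $$ (k, c))"
  unfolding index_mult_mat_sum[OF assms] by (auto simp: bool_sum_iff times_bool_def)

text \<open>A Boolean combination is the join of a selected set \<open>K\<close> of columns.
  Irredundancy thus says that a column can be a join only if it is one of those joined.\<close>

lemma bool_column_irredundant:
  fixes W :: "bool mat"
  assumes W: "W \<in> carrier_mat N R" and rank: "semiring_rank W = R"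
    and j: "j < R" and K: "K \<subseteq> {0..<R}"
    and eq: "\<And>r. r < N \<Longrightarrow> W $$ (r, j) \<longleftrightarrow> (\<exists>k\<in>K. W $$ (r, k))"
  shows "j \<in> K"
proof (rule ccontr)
  assume "j \<notin> K"
  \<comment> \<open>The truth value of \<open>k \<in> K\<close> serves directly as a coefficient of
    the semiring.\<close>
  then have "W $$ (r, j) = (\<Sum>k\<in>{0..<R} - {j}. W $$ (r, k) * (k \<in> K))" if "r < N" for r
    using that K eq by (auto simp: bool_sum_iff times_bool_def)
  then show False by (rule column_irredundant[OF W rank j])
qed

lemma bool_columns_inj:
  fixes W :: "bool mat"
  assumes W: "W \<in> carrier_mat N R" and rank: "semiring_rank W = R"
    and ij: "i < R" "j < R" and eq: "\<And>r. r < N \<Longrightarrow> W $$ (r, i) = W $$ (r, j)"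
  shows "i = j"
  using bool_column_irredundant[OF W rank ij(1), of "{j}"] ij eq by auto

text \<open>The inverse is the transpose. One product is the identity because \<open>f\<close> is
  injective, the other because \<open>f\<close> also reaches every index.\<close>

lemma permutation_mat_invertible:
  assumes f: "bij_betw f {0..<R} {0..<R}"
  shows "invertible_mat (mat R R (\<lambda>(k, j). if k = f j then 1 else 0 :: 'a :: comm_semiring_1))"
    (is "invertible_mat ?U")
proof -
  have fR: "f j < R" if "j < R" for j using f that by (auto simp: bij_betw_def)
  have inj: "f i = f j \<longleftrightarrow> i = j" if "i < R" "j < R" for i j
    using f that by (auto simp: bij_betw_def inj_on_def)
  let ?V = "mat R R (\<lambda>(j, k). if k = f j then 1 else 0 :: 'a)"
  have U: "?U \<in> carrier_mat R R" and V: "?V \<in> carrier_mat R R" by auto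
  have "?V * ?U = 1\<^sub>m R"
  proof (rule eq_matI)
    fix i j assume "i < dim_row (1\<^sub>m R :: 'a mat)" "j < dim_col (1\<^sub>m R :: 'a mat)"
    then have ij: "i < R" "j < R" by auto
    have "(?V * ?U) $$ (i, j)
        = (\<Sum>k\<in>{0..<R}. (if k = f i then (if f i = f j then 1 else 0) else 0))"
      unfolding index_mult_mat_sum[OF V U ij] by (rule sum.cong) (use ij in auto)
    also have "\<dots> = (1\<^sub>m R :: 'a mat) $$ (i, j)" using ij fR inj by simp
    finally show "(?V * ?U) $$ (i, j) = 1\<^sub>m R $$ (i, j)" .
  qed auto
  moreover have "?U * ?V = 1\<^sub>m R"
  proof (rule eq_matI)
    fix a b assume "a < dim_row (1\<^sub>m R :: 'a mat)" "b < dim_col (1\<^sub>m R :: 'a mat)"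
    then have ab: "a < R" "b < R" by auto
    have "(?U * ?V) $$ (a, b) = (\<Sum>j\<in>{0..<R}. if a = f j \<and> b = f j then 1 else 0)"
      unfolding index_mult_mat_sum[OF U V ab] by (rule sum.cong) (use ab in auto)
    \<comment> \<open>Summing over the values \<open>k = f j\<close> instead of \<open>j\<close>
      lets the sum collapse at \<open>k = a\<close> without naming the inverse of
      \<open>f\<close>.\<close>
    also have "\<dots> = (\<Sum>k\<in>{0..<R}. if a = k \<and> b = k then 1 else 0)"
      by (rule sum.reindex_bij_betw[OF f])
    also have "\<dots> = (\<Sum>k\<in>{0..<R}. if k = a then (if b = a then 1 else 0) else 0)"
      by (rule sum.cong) auto
    also have "\<dots> = (1\<^sub>m R :: 'a mat) $$ (a, b)" using ab by simp
    finally show "(?U * ?V) $$ (a, b) = 1\<^sub>m R $$ (a, b)" .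
  qed auto
  ultimately show ?thesis
    using U V unfolding invertible_mat_def inverts_mat_def by auto
qed

text \<open>Absorption is why a new matrix must be built: if \<open>W\<^sub>1\<close> has columns
  \<open>a\<close> and \<open>b\<close> with \<open>a\<close> below \<open>b\<close>, then
  \<open>b\<close> is also the join of \<open>a\<close> and \<open>b\<close>, so the non-invertible
  matrix with rows (1, 1) and (0, 1) fixes \<open>W\<^sub>1\<close>. The replacement
  \<open>Q\<close> records which column of \<open>W\<^sub>1\<close> each column of
  \<open>W\<^sub>2\<close> equals.\<close>

lemma bool_change_of_generators:
  fixes W\<^sub>1 W\<^sub>2 U V :: "bool mat"
  assumes W: "W\<^sub>1 \<in> carrier_mat N R" "W\<^sub>2 \<in> carrier_mat N R"
    and rank: "semiring_rank W\<^sub>1 = R" "semiring_rank W\<^sub>2 = R"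
    and UV: "U \<in> carrier_mat R R" "V \<in> carrier_mat R R"
    and eq: "W\<^sub>2 = W\<^sub>1 * U" "W\<^sub>1 = W\<^sub>2 * V"
  shows "\<exists>U \<in> carrier_mat R R. invertible_mat U \<and> W\<^sub>2 = W\<^sub>1 * U"
proof -
  have e2: "W\<^sub>2 $$ (r, j) \<longleftrightarrow> (\<exists>k<R. W\<^sub>1 $$ (r, k) \<and> U $$ (k, j))" if "r < N" "j < R" for r j
    using bool_mult_mat_iff[OF W(1) UV(1) that] eq(1) by simp
  have e1: "W\<^sub>1 $$ (r, k) \<longleftrightarrow> (\<exists>j<R. W\<^sub>2 $$ (r, j) \<and> V $$ (j, k))" if "r < N" "k < R" for r k
    using bool_mult_mat_iff[OF W(2) UV(2) that] eq(2) by simp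
  have "\<exists>k<R. \<forall>r<N. W\<^sub>2 $$ (r, j) = W\<^sub>1 $$ (r, k)" if j: "j < R" for j
  proof -
    \<comment> \<open>Column \<open>j\<close> of \<open>W\<^sub>2\<close> is the join of the columns \<open>l\<close> of \<open>W\<^sub>2\<close> with \<open>(V U)\<^sub>l\<^sub>j = 1\<close>; if \<open>j\<close> is among
      them via \<open>k\<close>, column \<open>k\<close> of \<open>W\<^sub>1\<close> lies both above and below it.\<close>
    have "j \<in> {l\<in>{0..<R}. \<exists>k<R. V $$ (l, k) \<and> U $$ (k, j)}"
    proof (rule bool_column_irredundant[OF W(2) rank(2) j])
      fix r assume r: "r < N"
      have "W\<^sub>2 $$ (r, j) \<longleftrightarrow> (\<exists>k<R. (\<exists>l<R. W\<^sub>2 $$ (r, l) \<and> V $$ (l, k)) \<and> U $$ (k, j))"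
        using e2[OF r j] e1[OF r] by metis
      then show "W\<^sub>2 $$ (r, j) \<longleftrightarrow>
          (\<exists>l\<in>{l\<in>{0..<R}. \<exists>k<R. V $$ (l, k) \<and> U $$ (k, j)}. W\<^sub>2 $$ (r, l))"
        by auto
    qed auto
    then obtain k where k: "k < R" "V $$ (j, k)" "U $$ (k, j)" by blast
    have "W\<^sub>2 $$ (r, j) = W\<^sub>1 $$ (r, k)" if "r < N" for r
    proof
      assume "W\<^sub>2 $$ (r, j)"
      then show "W\<^sub>1 $$ (r, k)" using e1[OF that k(1)] k(2) j by metis
    next
      assume "W\<^sub>1 $$ (r, k)"
      then show "W\<^sub>2 $$ (r, j)" using e2[OF that j] k(1,3) by metis
    qed
    then show ?thesis using k(1) by blast
  qed
  then obtain f where f: "\<And>j. j < R \<Longrightarrow> f j < R \<and> (\<forall>r<N. W\<^sub>2 $$ (r, j) = W\<^sub>1 $$ (r, f j))"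
    by metis
  \<comment> \<open>If \<open>f i = f j\<close>, columns \<open>i\<close> and \<open>j\<close> of
    \<open>W\<^sub>2\<close> agree, which full rank excludes for distinct indices. An injective
    self-map of a finite set is a bijection.\<close>
  have "inj_on f {0..<R}"
  proof (rule inj_onI)
    fix i j assume "i \<in> {0..<R}" "j \<in> {0..<R}" and "f i = f j"
    then show "i = j" using bool_columns_inj[OF W(2) rank(2)] f by auto
  qed
  moreover have "f ` {0..<R} \<subseteq> {0..<R}" using f by auto
  ultimately have bij: "bij_betw f {0..<R} {0..<R}"
    by (simp add: bij_betw_def endo_inj_surj)
  define Q where "Q = mat R R (\<lambda>(k, j). if k = f j then 1 else 0 :: bool)"
  have Q: "Q \<in> carrier_mat R R" by (simp add: Q_def)
  have "W\<^sub>2 = W\<^sub>1 * Q"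
  proof (rule eq_matI)
    fix r j assume "r < dim_row (W\<^sub>1 * Q)" "j < dim_col (W\<^sub>1 * Q)"
    then have rj: "r < N" "j < R" using W Q by auto
    then show "W\<^sub>2 $$ (r, j) = (W\<^sub>1 * Q) $$ (r, j)"
      using bool_mult_mat_iff[OF W(1) Q rj] f[OF rj(2)]
      by (auto simp: Q_def one_bool_def zero_bool_def)
  qed (use W Q in auto)
  then show ?thesis using Q permutation_mat_invertible[OF bij] unfolding Q_def by blast
qed

theorem proposition4:
  shows
    "(\<forall>N M R. \<forall>X :: nnreal mat.
        X \<in> carrier_mat N M \<and> semiring_rank X = R \<longrightarrow>
        (unique_left_factor R X \<longleftrightarrow>
         (\<exists>!C. is_cone N C \<and> finitely_generated N C \<and> cone_order N C = R \<and>
                cone_of_mat X \<subseteq> C))) \<and>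
     (\<forall>N M R. \<forall>X :: bool mat.
        X \<in> carrier_mat N M \<and> semiring_rank X = R \<longrightarrow>
        (unique_left_factor R X \<longleftrightarrow>
         (\<exists>!C. is_cone N C \<and> finitely_generated N C \<and> cone_order N C = R \<and>
                cone_of_mat X \<subseteq> C)))"
proof (intro conjI allI impI; elim conjE)
  fix N M R and X :: "nnreal mat"
  assume "X \<in> carrier_mat N M" "semiring_rank X = R"
  then show "unique_left_factor R X \<longleftrightarrow>
      (\<exists>!C. is_cone N C \<and> finitely_generated N C \<and> cone_order N C = R \<and> cone_of_mat X \<subseteq> C)"
    by (rule unique_left_factor_iff_unique_cone) (rule nnreal_change_of_generators)
next
  fix N M R and X :: "bool mat"
  assume "X \<in> carrier_mat N M" "semiring_rank X = R"
  then show "unique_left_factor R X \<longleftrightarrow>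
      (\<exists>!C. is_cone N C \<and> finitely_generated N C \<and> cone_order N C = R \<and> cone_of_mat X \<subseteq> C)"
    by (rule unique_left_factor_iff_unique_cone) (rule bool_change_of_generators)
qed

end
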